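(* Let $N>p>1$, $s>-p$, $0<\mu<\bar\mu:=\big(\frac{N-p}{p}\big)^p$ and $q>p-1$, and let $v>0$ be a solution on $(R_0,+\infty)$, $R_0>0$, of $$-\big(r^{N-1}|v'|^{p-2}v'\big)'=\mu\,r^{N-1-p}v^{p-1}+r^{N-1+s}v^{q},\qquad r>R_0.$$ Then $v'(r)<0$ for all large $r$ and $\lim_{r\to+\infty}v(r)=0$. Moreover, with $$x(t):=-\frac{r\,v'(r)}{v(r)},\qquad Y(t):=r^{p+s}v(r)^{q-p+1},\qquad t=\ln r,$$ there is $t_0\in\mathbb{R}$ such that $$0<x(t)<\nu_+\ \text{ for every }t\ge t_0,\qquad \liminf_{t\to\infty}x(t)>0,\qquad \sup_{t\ge t_0}Y(t)<+\infty .$$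
   Context: $N,p,s,\mu,q$ are real parameters. A solution of the ODE on $(R_0,+\infty)$ means a positive function $v\in C^1((R_0,+\infty))$ such that $r\mapsto r^{N-1}|v'|^{p-2}v'$ is of class $C^1$ and the equation holds pointwise. Set $h(\gamma):=\gamma^{p-1}\big(N-p-(p-1)\gamma\big)$ for $\gamma>0$. Since $0<\mu<\bar\mu=\max h$, the equation $h(\nu)=\mu$ has exactly two roots $\nu_-,\nu_+$, with $0<\nu_-<\frac{N-p}{p}<\nu_+<\frac{N-p}{p-1}$; $\nu_+$ denotes the larger one. *)

theory Defs
  imports "HOL-Analysis.Analysis"
begin

(* Where the derivative vanishes, the factor deriv v r makes the product 0 for every p,
   including p <= 2, which is the usual convention for |v'|^(p-2) v' with p > 1. *)
definition flux :: "real \<Rightarrow> real \<Rightarrow> (real \<Rightarrow> real) \<Rightarrow> real \<Rightarrow> real" where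
  "flux N p v r = r powr (N - 1) * \<bar>deriv v r\<bar> powr (p - 2) * deriv v r"

(* v is a total function, but only its values on the open half-line {R0<..} matter. *)
definition positive_solution ::
    "real \<Rightarrow> real \<Rightarrow> real \<Rightarrow> real \<Rightarrow> real \<Rightarrow> real \<Rightarrow> (real \<Rightarrow> real) \<Rightarrow> bool" where
  "positive_solution N p s \<mu> q R0 v \<longleftrightarrow>
     (\<forall>r>R0. v r > 0) \<and>
     v C1_differentiable_on {R0<..} \<and>
     flux N p v C1_differentiable_on {R0<..} \<and>
     (\<forall>r>R0. - deriv (flux N p v) r =
        \<mu> * r powr (N - 1 - p) * v r powr (p - 1) + r powr (N - 1 + s) * v r powr q)"

definition h :: "real \<Rightarrow> real \<Rightarrow> real \<Rightarrow> real" where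
  "h N p \<gamma> = \<gamma> powr (p - 1) * (N - p - (p - 1) * \<gamma>)"

(* For 0 < \<mu> < ((N - p) / p) powr p the equation has exactly two positive roots. *)
definition nu_plus :: "real \<Rightarrow> real \<Rightarrow> real \<Rightarrow> real" where
  "nu_plus N p \<mu> = (GREATEST \<gamma>. \<gamma> > 0 \<and> h N p \<gamma> = \<mu>)"

(* Both quantities are functions of t = ln r, that is r = exp t. *)
definition x_of :: "(real \<Rightarrow> real) \<Rightarrow> real \<Rightarrow> real" where
  "x_of v t = (let r = exp t in - (r * deriv v r / v r))"

definition Y_of :: "real \<Rightarrow> real \<Rightarrow> real \<Rightarrow> (real \<Rightarrow> real) \<Rightarrow> real \<Rightarrow> real" where
  "Y_of p s q v t = (let r = exp t in r powr (p + s) * v r powr (q - p + 1))"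

end

theory Submission
  imports Defs "HOL-Real_Asymp.Real_Asymp"
begin

text \<open>The flux is strictly decreasing. If it stayed nonnegative, \<open>v\<close> would be bounded below by a
  positive constant and the flux would tend to \<open>-\<infinity>\<close>, so \<open>v'\<close> is eventually negative.
  In the variable \<open>t = ln r\<close> the function \<open>z = x powr (p - 1)\<close> solves
  \<open>z' = \<mu> - h(x) + Y\<close>, while \<open>Y' = Y (p + s - (q - p + 1) x)\<close>. Since \<open>h \<le> \<mu>\<close> beyond \<open>\<nu>\<^sub>+\<close>, an orbit
  that reaches \<open>\<nu>\<^sub>+\<close> keeps increasing and blows up in finite time, as \<open>x' \<ge> x\<^sup>2 / 2\<close> for large \<open>x\<close>.
  The inequality \<open>z' \<ge> \<mu> - (N - p) z\<close> keeps \<open>x\<close> away from \<open>0\<close>, so \<open>v\<close> decays like a power.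
  As \<open>x\<close> is bounded, \<open>Y\<close> decays at most exponentially, so a large value of \<open>Y\<close> would make \<open>z\<close>
  exceed its bound one unit of time later.\<close>

section \<open>Differential inequalities on an interval\<close>

text \<open>The times in \<open>{a..b}\<close> with \<open>Z \<le> z t\<close> form a nonempty
  compact set. At its last element \<open>m\<close> the derivative is positive, so
  \<open>m < b\<close> would give a later element.\<close>

lemma barrier:
  fixes z z' :: "real \<Rightarrow> real"
  assumes der: "\<And>t. a \<le> t \<Longrightarrow> (z has_real_derivative z' t) (at t)"
    and pos: "\<And>t. a \<le> t \<Longrightarrow> Z \<le> z t \<Longrightarrow> 0 < z' t"
    and start: "Z \<le> z a" and "a \<le> b"
  shows "Z \<le> z b"
proof (rule ccontr)
  assume "\<not> Z \<le> z b"
  have cont: "continuous_on {a..b} z"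
    by (rule DERIV_continuous_on[where D = z']) (auto intro: has_field_derivative_at_within der)
  define S where "S = {t \<in> {a..b}. Z \<le> z t}"
  have "S = {a..b} \<inter> z -` {Z..}" by (auto simp: S_def)
  then have "closed S" using continuous_closed_preimage[OF cont] by simp
  moreover have "bounded S"
    by (rule bounded_subset[of "{a..b}"]) (auto simp: S_def)
  ultimately have "compact S" by (simp add: compact_eq_bounded_closed)
  moreover have "S \<noteq> {}" using start \<open>a \<le> b\<close> by (auto simp: S_def)
  ultimately obtain m where m: "m \<in> S" "\<And>t. t \<in> S \<Longrightarrow> t \<le> m"
    using compact_attains_sup[of S] by metis
  have "m < b" using m(1) \<open>\<not> Z \<le> z b\<close> by (auto simp: S_def less_le)
  have "a \<le> m" "Z \<le> z m" using m(1) by (auto simp: S_def)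
  then obtain d where d: "d > 0" "\<And>k. k > 0 \<Longrightarrow> k < d \<Longrightarrow> z m < z (m + k)"
    using DERIV_pos_inc_right[OF der[of m] pos[of m]] by blast
  \<comment> \<open>Small enough for the local increase at \<open>m\<close>, and clipped so that
    \<open>m + k\<close> does not leave the interval.\<close>
  define k where "k = min (d / 2) (b - m)"
  have "k > 0" "k < d" "m + k \<le> b" using d(1) \<open>m < b\<close> by (auto simp: k_def)
  then have "m + k \<in> S" using d(2)[of k] m(1) by (auto simp: S_def)
  then show False using m(2) \<open>k > 0\<close> by fastforce
qed

lemma increment_ge:
  fixes f f' :: "real \<Rightarrow> real"
  assumes der: "\<And>t. a \<le> t \<Longrightarrow> t \<le> b \<Longrightarrow> (f has_real_derivative f' t) (at t)"
    and ge: "\<And>t. a \<le> t \<Longrightarrow> t \<le> b \<Longrightarrow> c \<le> f' t" and "a \<le> b"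
  shows "f a + c * (b - a) \<le> f b"
proof -
  have "f a - c * a \<le> f b - c * b"
  proof (rule DERIV_nonneg_imp_nondecreasing[OF \<open>a \<le> b\<close>])
    fix t assume t: "a \<le> t" "t \<le> b"
    have "((\<lambda>t. f t - c * t) has_real_derivative f' t - c) (at t)"
      by (auto intro!: derivative_eq_intros der t)
    then show "\<exists>y. ((\<lambda>t. f t - c * t) has_real_derivative y) (at t) \<and> 0 \<le> y"
      using ge[OF t] by (intro exI[of _ "f' t - c"]) auto
  qed
  then show ?thesis by (simp add: algebra_simps)
qed

text \<open>Gronwall's inequality from below, by the integrating factor
  \<open>exp (- c * t)\<close>. Neither \<open>c\<close> nor \<open>f\<close> needs a sign, so
  decaying and negated functions are covered too.\<close>

lemma exp_growth_ge:
  fixes f f' :: "real \<Rightarrow> real"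
  assumes der: "\<And>t. a \<le> t \<Longrightarrow> t \<le> b \<Longrightarrow> (f has_real_derivative f' t) (at t)"
    and ge: "\<And>t. a \<le> t \<Longrightarrow> t \<le> b \<Longrightarrow> c * f t \<le> f' t" and "a \<le> b"
  shows "f a * exp (c * (b - a)) \<le> f b"
proof -
  \<comment> \<open>The summand \<open>0 * (b - a)\<close> matches the form of
    \<open>increment_ge\<close> with slope zero.\<close>
  have "f a * exp (- c * a) + 0 * (b - a) \<le> f b * exp (- c * b)"
  proof (rule increment_ge[OF _ _ \<open>a \<le> b\<close>])
    fix t assume t: "a \<le> t" "t \<le> b"
    show "((\<lambda>t. f t * exp (- c * t)) has_real_derivative (f' t - c * f t) * exp (- c * t)) (at t)"
      by (auto intro!: derivative_eq_intros der t simp: algebra_simps)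
    show "0 \<le> (f' t - c * f t) * exp (- c * t)" using ge[OF t] by simp
  qed
  then have "f a * exp (- c * a) * exp (c * b) \<le> f b * exp (- c * b) * exp (c * b)" by simp
  then show ?thesis by (simp add: mult.assoc exp_add[symmetric] algebra_simps)
qed

section \<open>The function \<open>h\<close> and its larger root\<close>

lemma h_continuous_on: "1 < p \<Longrightarrow> continuous_on {0<..} (h N p)"
  unfolding h_def by (intro continuous_intros) auto

text \<open>The derivative factors as \<open>(p - 1) * g powr (p - 2) * (N - p - p * g)\<close>, and
  its last factor is nonpositive from \<open>(N - p) / p\<close> on.\<close>

lemma h_antimono:
  assumes "1 < p" "p < N" "(N - p) / p \<le> x" "x \<le> y"
  shows "h N p y \<le> h N p x"
proof (rule DERIV_nonpos_imp_nonincreasing[OF \<open>x \<le> y\<close>])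
  fix g assume g: "x \<le> g" "g \<le> y"
  have "0 < (N - p) / p" using assms by simp
  then have g0: "0 < g" using assms g by linarith
  have "N - p \<le> p * g" using order_trans[OF assms(3) g(1)] assms(1)
    by (simp add: pos_divide_le_eq mult.commute)
  have "(h N p has_real_derivative
      (p - 1) * g powr (p - 1 - 1) * (N - p - (p - 1) * g) + (1 - p) * g powr (p - 1)) (at g)"
    unfolding h_def using g0 by (auto intro!: derivative_eq_intros)
  moreover have "g powr (p - 1) = g powr (p - 1 - 1) * g"
    using powr_mult_base[of g "p - 1 - 1"] g0 by (simp add: mult.commute)
  then have "(p - 1) * g powr (p - 1 - 1) * (N - p - (p - 1) * g) + (1 - p) * g powr (p - 1)
      = (p - 1) * g powr (p - 1 - 1) * (N - p - p * g)" by (simp add: algebra_simps)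
  moreover have "\<dots> \<le> 0" using \<open>N - p \<le> p * g\<close> assms by (intro mult_nonneg_nonpos) auto
  ultimately show "\<exists>d. (h N p has_real_derivative d) (at g) \<and> d \<le> 0" by metis
qed

text \<open>\<open>GREATEST\<close> has the intended meaning only if a largest root exists. The
  intermediate value theorem gives a root between the maximum point \<open>a\<close> and the zero
  \<open>b\<close> of \<open>h\<close>; the roots there form a compact set, whose maximum dominates
  all positive roots.\<close>

lemma nu_plus:
  assumes "1 < p" "p < N" "0 < \<mu>" "\<mu> < ((N - p) / p) powr p"
  shows nu_plus_ge: "(N - p) / p \<le> nu_plus N p \<mu>"
    and h_nu_plus: "h N p (nu_plus N p \<mu>) = \<mu>"
    and h_neq_beyond_nu_plus: "nu_plus N p \<mu> < \<gamma> \<Longrightarrow> h N p \<gamma> \<noteq> \<mu>"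
proof -
  define a b where "a = (N - p) / p" and "b = (N - p) / (p - 1)"
  have ab: "0 < a" "a \<le> b" using assms by (auto simp: a_def b_def intro!: divide_left_mono)
  \<comment> \<open>At \<open>a\<close> the linear factor of \<open>h\<close> is \<open>a\<close>
    itself, so \<open>h\<close> takes there the value that bounds \<open>\<mu>\<close> from
    above.\<close>
  have "N - p - (p - 1) * a = a" using assms by (simp add: a_def field_simps)
  then have "h N p a = a powr p" using ab by (simp add: h_def powr_diff)
  then have ha: "\<mu> < h N p a" using assms by (simp add: a_def)
  have hb: "h N p b = 0" using assms by (simp add: h_def b_def)
  have cont: "continuous_on {a..b} (h N p)"
    by (rule continuous_on_subset[OF h_continuous_on]) (use assms ab in auto)
  define S where "S = {g \<in> {a..b}. h N p g = \<mu>}"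
  have "S \<noteq> {}"
    using IVT2'[of "h N p" b \<mu> a] ha hb assms ab cont by (auto simp: S_def)
  moreover have "compact S"
  proof -
    have "S = {a..b} \<inter> h N p -` {\<mu>}" by (auto simp: S_def)
    then have "closed S" using continuous_closed_preimage[OF cont] by simp
    moreover have "bounded S"
      by (rule bounded_subset[of "{a..b}"]) (auto simp: S_def)
    ultimately show ?thesis by (simp add: compact_eq_bounded_closed)
  qed
  ultimately obtain m where m: "m \<in> S" "\<And>t. t \<in> S \<Longrightarrow> t \<le> m"
    using compact_attains_sup[of S] by metis
  \<comment> \<open>Since \<open>\<mu>\<close> is positive, so is the linear factor at a root, which
    puts the root below \<open>b\<close>. Roots to the left of \<open>a\<close> are below
    \<open>m\<close> anyway.\<close>
  have max: "g \<le> m" if g: "0 < g" "h N p g = \<mu>" for g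
  proof -
    have "0 < g powr (p - 1) * (N - p - (p - 1) * g)" using g assms by (simp add: h_def)
    then have "0 < N - p - (p - 1) * g" using g by (simp add: zero_less_mult_iff)
    then have "g \<le> b" using assms by (simp add: b_def pos_le_divide_eq mult.commute)
    then show ?thesis using m g by (cases "a \<le> g") (auto simp: S_def)
  qed
  have eq: "nu_plus N p \<mu> = m" unfolding nu_plus_def
    using m(1) ab max by (intro Greatest_equality) (auto simp: S_def)
  show "(N - p) / p \<le> nu_plus N p \<mu>" "h N p (nu_plus N p \<mu>) = \<mu>"
    using m(1) eq by (auto simp: S_def a_def)
  show "nu_plus N p \<mu> < \<gamma> \<Longrightarrow> h N p \<gamma> \<noteq> \<mu>"
    using max[of \<gamma>] m(1) ab eq by (auto simp: S_def)
qed

section \<open>A priori bounds for the system in logarithmic time\<close>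

text \<open>The bounds use only the two differential equations and the positivity of
  \<open>x\<close> and \<open>Y\<close>, so \<open>v\<close> does not appear. The first equation is
  stated for \<open>z\<close>, which is a rescaled flux, because the radial equation prescribes the
  derivative of the flux.\<close>

locale logarithmic_system =
  fixes N p s \<mu> q a :: real and x z Y :: "real \<Rightarrow> real"
  assumes p1: "1 < p" and pN: "p < N"
    and mu_pos: "0 < \<mu>" and mu_less: "\<mu> < ((N - p) / p) powr p" and qp: "q > p - 1"
    and ps: "s > - p"
    and x_pos: "\<And>t. a \<le> t \<Longrightarrow> 0 < x t"
    and z_eq: "\<And>t. a \<le> t \<Longrightarrow> z t = x t powr (p - 1)"
    and Y_pos: "\<And>t. a \<le> t \<Longrightarrow> 0 < Y t"
    and z_deriv: "\<And>t. a \<le> t \<Longrightarrow> (z has_real_derivative \<mu> - h N p (x t) + Y t) (at t)"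
    and Y_deriv: "\<And>t. a \<le> t \<Longrightarrow>
      (Y has_real_derivative Y t * (p + s - (q - p + 1) * x t)) (at t)"
begin

lemma z_pos: "a \<le> t \<Longrightarrow> 0 < z t"
  using x_pos[of t] by (simp add: z_eq)

lemma x_eq: "a \<le> t \<Longrightarrow> x t = z t powr (1 / (p - 1))"
  using x_pos[of t] p1 by (simp add: z_eq powr_powr)

lemma h_eq: "a \<le> t \<Longrightarrow> h N p (x t) = z t * (N - p - (p - 1) * x t)"
  by (simp add: h_def z_eq)

lemma z_le_iff: "a \<le> t \<Longrightarrow> 0 < g \<Longrightarrow> g powr (p - 1) \<le> z t \<longleftrightarrow> g \<le> x t"
  using x_pos[of t] p1 powr_mono2[of "p - 1" g "x t"] powr_less_mono2[of "p - 1" "x t" g]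
  by (auto simp: z_eq not_le[symmetric])

text \<open>The reciprocal \<open>u = 1 / x\<close> would decrease with slope at most
  \<open>- 1 / 2\<close> forever and become negative in finite time.\<close>

lemma no_blow_up:
  assumes "a \<le> b" and large: "\<And>t. b \<le> t \<Longrightarrow> 2 * (N - p) / (p - 1) \<le> x t"
  shows False
proof -
  define u where "u t = z t powr (- 1 / (p - 1))" for t
  \<comment> \<open>Over the length \<open>2 * u b + 2\<close> the function \<open>u\<close> loses
    at least \<open>u b + 1\<close>.\<close>
  define c where "c = b + 2 * u b + 2"
  have u_eq: "u t * x t = 1" if "a \<le> t" for t
    using z_pos[OF that] by (simp add: u_def x_eq[OF that] powr_minus flip: minus_divide_left)
  have "u b > 0" using z_pos[OF \<open>a \<le> b\<close>] by (simp add: u_def)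
  have "- u b + 1 / 2 * (c - b) \<le> - u c"
  proof (rule increment_ge)
    show "b \<le> c" using \<open>u b > 0\<close> by (simp add: c_def)
    fix t assume t: "b \<le> t"
    then have at: "a \<le> t" using \<open>a \<le> b\<close> by simp
    let ?z' = "\<mu> - h N p (x t) + Y t"
    have "((\<lambda>t. - u t) has_real_derivative
        1 / (p - 1) * z t powr (- 1 / (p - 1) - 1) * ?z') (at t)"
      unfolding u_def using z_pos[OF at]
      by (auto intro!: derivative_eq_intros z_deriv[OF at])
    moreover have "z t powr (- 1 / (p - 1) - 1) = u t / z t"
      using z_pos[OF at] by (simp add: u_def powr_diff)
    ultimately show "((\<lambda>t. - u t) has_real_derivative u t * ?z' / ((p - 1) * z t)) (at t)"
      by (simp add: mult.commute)
    \<comment> \<open>The threshold is chosen so that at least half of \<open>(p - 1) * x t\<close>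
      survives the subtraction of \<open>N - p\<close>.\<close>
    have "2 * (N - p) \<le> (p - 1) * x t" using large[OF t] p1 by (simp add: divide_le_eq mult.commute)
    then have "(p - 1) * x t / 2 \<le> (p - 1) * x t - (N - p)" by argo
    then have "z t * ((p - 1) * x t / 2) \<le> z t * ((p - 1) * x t - (N - p))"
      using z_pos[OF at] by (intro mult_left_mono) auto
    then have "z t * ((p - 1) * x t / 2) \<le> ?z'"
      using mu_pos Y_pos[OF at] h_eq[OF at] by (simp add: algebra_simps)
    then have "u t * (z t * ((p - 1) * x t / 2)) \<le> u t * ?z'"
      by (intro mult_left_mono) (auto simp: u_def)
    moreover have "u t * (z t * ((p - 1) * x t / 2)) = (p - 1) * z t / 2 * (u t * x t)"
      by simp
    ultimately show "1 / 2 \<le> u t * ?z' / ((p - 1) * z t)"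
      using z_pos[OF at] p1 by (simp add: u_eq[OF at] field_simps)
  qed
  moreover have "1 / 2 * (c - b) = u b + 1" by (simp add: c_def)
  ultimately have "u c < 0" by linarith
  then show False by (simp add: u_def not_less[symmetric])
qed

lemma nu_pos: "0 < nu_plus N p \<mu>"
proof -
  have "0 < (N - p) / p" using p1 pN by simp
  then show ?thesis using nu_plus_ge[OF p1 pN mu_pos mu_less] by linarith
qed

text \<open>Once at the root, \<open>x\<close> stays beyond it and \<open>z\<close> increases. A
  uniform lower bound for \<open>z'\<close> then makes \<open>x\<close> exceed the threshold of
  \<open>no_blow_up\<close> for good.\<close>

lemma x_less_nu_plus:
  assumes "a \<le> b"
  shows "x b < nu_plus N p \<mu>"
proof (rule ccontr)
  let ?n = "nu_plus N p \<mu>"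
  note nu = nu_plus_ge[OF p1 pN mu_pos mu_less] h_nu_plus[OF p1 pN mu_pos mu_less]
    h_neq_beyond_nu_plus[OF p1 pN mu_pos mu_less]
  assume "\<not> x b < ?n"
  then have start: "?n powr (p - 1) \<le> z b" using z_le_iff[OF assms nu_pos] by simp
  have z'_pos: "0 < \<mu> - h N p (x t) + Y t" if "b \<le> t" "?n powr (p - 1) \<le> z t" for t
  proof -
    have at: "a \<le> t" using assms that by simp
    have "?n \<le> x t" using z_le_iff[OF at nu_pos] that by simp
    then have "h N p (x t) \<le> \<mu>" using h_antimono[OF p1 pN nu(1)] nu(2) by simp
    then show ?thesis using Y_pos[OF at] by simp
  qed
  have zge: "?n powr (p - 1) \<le> z t" if "b \<le> t" for t
    using barrier[of b z "\<lambda>t. \<mu> - h N p (x t) + Y t", OF z_deriv z'_pos start that] assms by simp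
  have mono: "z t < z t'" if "b \<le> t" "t < t'" for t t'
  proof (rule DERIV_pos_imp_increasing[OF that(2)])
    fix y assume "t \<le> y"
    then show "\<exists>d. (z has_real_derivative d) (at y) \<and> 0 < d"
      using that assms z_deriv[of y] z'_pos[of y] zge[of y] by auto
  qed
  \<comment> \<open>At the root itself \<open>\<mu> - h\<close> vanishes and only \<open>Y\<close>
    drives \<open>z\<close>, with no uniform lower bound at hand. One unit of time later
    \<open>x\<close> is strictly beyond the root, and \<open>\<mu> - h N p g\<close> is a positive
    constant.\<close>
  define g where "g = x (b + 1)"
  have g: "a \<le> b + 1" "0 < g" using assms x_pos by (auto simp: g_def)
  have "?n powr (p - 1) < z (b + 1)" using start mono[of b "b + 1"] by simp
  then have "?n < g"
    using z_eq[OF g(1)] g p1 powr_mono2[of "p - 1" g "nu_plus N p \<mu>"]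
    by (force simp: g_def not_le[symmetric])
  then have "h N p g < \<mu>"
    using nu(3)[of g] h_antimono[OF p1 pN nu(1), of g] nu(2) by simp
  define c where "c = \<mu> - h N p g"
  have "c > 0" using \<open>h N p g < \<mu>\<close> by (simp add: c_def)
  have z'_ge: "c \<le> \<mu> - h N p (x t) + Y t" if "b + 1 \<le> t" for t
  proof -
    have at: "a \<le> t" using assms that by simp
    have "z (b + 1) \<le> z t" using mono[of "b + 1" t] that by (cases "t = b + 1") auto
    then have "g powr (p - 1) \<le> z t" using z_eq[OF g(1)] by (simp add: g_def)
    then have "g \<le> x t" using z_le_iff[OF at g(2)] by simp
    moreover have "(N - p) / p \<le> g" using nu(1) \<open>?n < g\<close> by simp
    ultimately have "h N p (x t) \<le> h N p g" using h_antimono[OF p1 pN] by simp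
    then show ?thesis using Y_pos[OF at] by (simp add: c_def)
  qed
  define X where "X = 2 * (N - p) / (p - 1)"
  have "X > 0" using p1 pN by (simp add: X_def)
  \<comment> \<open>With slope at least \<open>c\<close>, and starting from a positive value,
    \<open>z\<close> has passed \<open>X powr (p - 1)\<close> by this time.\<close>
  define d where "d = b + 1 + X powr (p - 1) / c"
  have "b + 1 \<le> d" using \<open>c > 0\<close> by (simp add: d_def)
  have "X \<le> x t" if "d \<le> t" for t
  proof -
    have bt: "b + 1 \<le> t" using \<open>b + 1 \<le> d\<close> that by simp
    have "z (b + 1) + c * (t - (b + 1)) \<le> z t"
      using increment_ge[of "b + 1" t z, OF z_deriv z'_ge bt] assms by simp
    moreover have "c * (d - (b + 1)) = X powr (p - 1)" using \<open>c > 0\<close> by (simp add: d_def)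
    moreover have "c * (d - (b + 1)) \<le> c * (t - (b + 1))"
      using \<open>c > 0\<close> that by (intro mult_left_mono) auto
    ultimately have "X powr (p - 1) \<le> z t" using z_pos[OF g(1)] by linarith
    then show ?thesis using z_le_iff[of t X] \<open>X > 0\<close> bt assms by simp
  qed
  then show False using no_blow_up[of d] \<open>b + 1 \<le> d\<close> assms by (simp add: X_def)
qed

text \<open>Dropping the nonnegative terms \<open>(p - 1) * x * z\<close> and \<open>Y\<close>
  leaves \<open>z' \<ge> \<mu> - A * z\<close>. Hence \<open>z - \<mu> / A\<close> lies above an
  exponential multiple of its initial value that tends to zero.\<close>

lemma eventually_x_ge: "\<exists>e>0. \<forall>\<^sub>F t in at_top. e \<le> x t"
proof -
  define A where "A = N - p"
  have A: "A > 0" using pN by (simp add: A_def)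
  \<comment> \<open>Half of the limiting lower bound \<open>\<mu> / A\<close> for \<open>z\<close>,
    expressed in terms of \<open>x\<close>.\<close>
  define e where "e = (\<mu> / A / 2) powr (1 / (p - 1))"
  have e: "e > 0" using A mu_pos by (simp add: e_def)
  have lower: "(z a - \<mu> / A) * exp (- A * (t - a)) \<le> z t - \<mu> / A" if t: "a \<le> t" for t
  proof (rule exp_growth_ge[OF _ _ t])
    fix y assume y: "a \<le> y"
    show "((\<lambda>t. z t - \<mu> / A) has_real_derivative \<mu> - h N p (x y) + Y y) (at y)"
      by (auto intro!: derivative_eq_intros z_deriv y)
    have "0 \<le> z y * ((p - 1) * x y)" using z_pos[OF y] x_pos[OF y] p1 by simp
    then show "- A * (z y - \<mu> / A) \<le> \<mu> - h N p (x y) + Y y"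
      using A Y_pos[OF y] by (simp add: h_eq[OF y] A_def[symmetric] algebra_simps)
  qed
  have "((\<lambda>t. (z a - \<mu> / A) * exp (- A * (t - a))) \<longlongrightarrow> 0) at_top"
    using A by real_asymp
  then have "\<forall>\<^sub>F t in at_top. - (\<mu> / A / 2) < (z a - \<mu> / A) * exp (- A * (t - a))"
    using A mu_pos by (intro order_tendstoD(1)) auto
  then have "\<forall>\<^sub>F t in at_top. e \<le> x t"
    using eventually_ge_at_top[of a]
  proof eventually_elim
    case (elim t)
    have "- (\<mu> / A / 2) < z t - \<mu> / A" using elim lower[of t] by simp
    then have "\<mu> / A / 2 \<le> z t" by simp
    moreover have "e powr (p - 1) = \<mu> / A / 2"
      using A mu_pos p1 by (simp add: e_def powr_powr)
    ultimately show ?case using z_le_iff[of t e] e elim by simp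
  qed
  then show ?thesis using e by blast
qed

text \<open>On a unit interval \<open>Y\<close> keeps at least the fraction \<open>exp (- M)\<close>
  of its initial value, so \<open>z\<close> grows by at least \<open>Y b * exp (- M) - K\<close>.
  The bound \<open>Z\<close> on \<open>z\<close> limits this growth.\<close>

lemma Y_bounded: "\<exists>B. \<forall>t\<ge>a. Y t \<le> B"
proof -
  define Z where "Z = nu_plus N p \<mu> powr (p - 1)"
  define M where "M = (q - p + 1) * nu_plus N p \<mu>"
  define K where "K = (N - p) * Z"
  have zZ: "z t \<le> Z" if "a \<le> t" for t
    using x_less_nu_plus[OF that] x_pos[OF that] p1
    by (auto simp: Z_def z_eq[OF that] intro!: powr_mono2)
  have "M \<ge> 0" using nu_pos qp by (simp add: M_def)
  have "Y b \<le> (Z + K) / exp (- M)" if b: "a \<le> b" for b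
  proof -
    have Yge: "Y b * exp (- M) \<le> Y t" if t: "b \<le> t" "t \<le> b + 1" for t
    proof -
      have "Y b * exp (- M * (t - b)) \<le> Y t"
      proof (rule exp_growth_ge[OF Y_deriv _ t(1)])
        fix y assume y: "b \<le> y"
        then have ay: "a \<le> y" using b by simp
        have "(q - p + 1) * x y \<le> M" unfolding M_def
          using x_less_nu_plus[OF ay] qp by (intro mult_left_mono) auto
        \<comment> \<open>Here \<open>p + s > 0\<close> is dropped, which leaves a decay rate of at
          most \<open>M\<close>.\<close>
        then have "Y y * (- M) \<le> Y y * (p + s - (q - p + 1) * x y)"
          using Y_pos[OF ay] ps by (intro mult_left_mono) auto
        then show "- M * Y y \<le> Y y * (p + s - (q - p + 1) * x y)" by (simp add: mult.commute)
      qed (use b in auto)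
      moreover have "M * (t - b) \<le> M * 1" using t \<open>M \<ge> 0\<close> by (intro mult_left_mono) auto
      then have "Y b * exp (- M) \<le> Y b * exp (- M * (t - b))"
        using Y_pos[OF b] by (intro mult_left_mono) auto
      ultimately show ?thesis by linarith
    qed
    have "z b + (Y b * exp (- M) - K) * (b + 1 - b) \<le> z (b + 1)"
    proof (rule increment_ge[OF z_deriv])
      fix t assume t: "b \<le> t" "t \<le> b + 1"
      then have at: "a \<le> t" using b by simp
      have "0 \<le> z t * ((p - 1) * x t)" using z_pos[OF at] x_pos[OF at] p1 by simp
      moreover have "z t * (N - p) \<le> K" unfolding K_def
        using zZ[OF at] pN by (simp add: mult.commute mult_left_mono)
      ultimately have "h N p (x t) \<le> K" by (simp add: h_eq[OF at] algebra_simps)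
      then show "Y b * exp (- M) - K \<le> \<mu> - h N p (x t) + Y t" using Yge[OF t] mu_pos by simp
    qed (use b in auto)
    then have "Y b * exp (- M) \<le> Z + K" using zZ[of "b + 1"] z_pos[OF b] b by simp
    then show ?thesis by (simp add: pos_le_divide_eq)
  qed
  then show ?thesis by blast
qed

end

section \<open>The radial equation and the eventual sign of the derivative\<close>

lemma C1_differentiable_on_imp_DERIV:
  fixes f :: "real \<Rightarrow> real"
  assumes "f C1_differentiable_on S" "x \<in> S"
  shows "(f has_real_derivative deriv f x) (at x)"
proof -
  obtain D where "(f has_vector_derivative D) (at x)"
    using assms unfolding C1_differentiable_on_def by blast
  then have "(f has_real_derivative D) (at x)"
    by (simp add: has_real_derivative_iff_has_vector_derivative)
  then show ?thesis using DERIV_imp_deriv by metis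
qed

lemma flux_neg_iff: "0 < r \<Longrightarrow> flux N p v r < 0 \<longleftrightarrow> deriv v r < 0"
  by (auto simp: flux_def mult_less_0_iff zero_less_mult_iff)

lemma flux_pos_iff: "0 < r \<Longrightarrow> 0 < flux N p v r \<longleftrightarrow> 0 < deriv v r"
  by (auto simp: flux_def zero_less_mult_iff mult_less_0_iff)

context
  fixes N p s \<mu> q R0 :: real and v :: "real \<Rightarrow> real"
  assumes p1: "1 < p" and pN: "p < N" and mu_pos: "0 < \<mu>" and R0: "R0 > 0"
    and sol: "positive_solution N p s \<mu> q R0 v"
begin

lemma v_pos: "R0 < r \<Longrightarrow> 0 < v r"
  using sol by (simp add: positive_solution_def)

lemma v_deriv: "R0 < r \<Longrightarrow> (v has_real_derivative deriv v r) (at r)"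
  using sol by (auto simp: positive_solution_def intro: C1_differentiable_on_imp_DERIV)

lemma flux_deriv:
  assumes "R0 < r"
  shows "(flux N p v has_real_derivative
    - (\<mu> * r powr (N - 1 - p) * v r powr (p - 1) + r powr (N - 1 + s) * v r powr q)) (at r)"
proof -
  have "flux N p v C1_differentiable_on {R0<..}"
    using sol by (simp add: positive_solution_def)
  then have "(flux N p v has_real_derivative deriv (flux N p v) r) (at r)"
    using assms by (intro C1_differentiable_on_imp_DERIV) auto
  moreover have "- deriv (flux N p v) r
      = \<mu> * r powr (N - 1 - p) * v r powr (p - 1) + r powr (N - 1 + s) * v r powr q"
    using sol assms unfolding positive_solution_def by blast
  ultimately show ?thesis by (metis minus_minus)
qed

lemma flux_less:
  assumes "R0 < r" "r < r'"
  shows "flux N p v r' < flux N p v r"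
proof (rule DERIV_neg_imp_decreasing[OF assms(2)])
  fix y assume "r \<le> y"
  then have y: "R0 < y" using assms by simp
  have "0 < \<mu> * y powr (N - 1 - p) * v y powr (p - 1) + y powr (N - 1 + s) * v y powr q"
    using y R0 v_pos[OF y] mu_pos by (intro add_pos_pos mult_pos_pos) auto
  then show "\<exists>d. (flux N p v has_real_derivative d) (at y) \<and> d < 0"
    using flux_deriv[OF y] by (metis neg_less_0_iff_less)
qed

text \<open>Otherwise the flux, being strictly decreasing, is positive everywhere and
  \<open>v\<close> increases. With \<open>v\<close> bounded below, the equation forces the flux down
  at least like \<open>- k * r powr (N - p)\<close>, which is unbounded because
  \<open>N > p\<close>.\<close>

lemma ex_flux_neg: "\<exists>r>R0. flux N p v r < 0"
proof (rule ccontr)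
  assume "\<not> ?thesis"
  then have nonneg: "0 \<le> flux N p v r" if "R0 < r" for r
    using that not_less by blast
  have dpos: "0 < deriv v r" if "R0 < r" for r
  proof -
    have "0 < flux N p v r" using flux_less[OF that, of "r + 1"] nonneg[of "r + 1"] that by simp
    then show ?thesis using flux_pos_iff that R0 by simp
  qed
  define b where "b = R0 + 1"
  define c where "c = v b"
  have b: "R0 < b" "0 < b" using R0 by (auto simp: b_def)
  have c: "0 < c" using v_pos b by (simp add: c_def)
  have vc: "c \<le> v r" if "b \<le> r" for r unfolding c_def
  proof (rule DERIV_nonneg_imp_nondecreasing[OF that])
    fix y assume "b \<le> y"
    then show "\<exists>d. (v has_real_derivative d) (at y) \<and> 0 \<le> d"
      using v_deriv[of y] dpos[of y] b by (intro exI[of _ "deriv v y"]) auto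
  qed
  \<comment> \<open>Makes \<open>k * r powr (N - p)\<close> an antiderivative of
    \<open>\<mu> * c powr (p - 1) * r powr (N - 1 - p)\<close>, the lower bound for the first term
    of the equation.\<close>
  define k where "k = \<mu> * c powr (p - 1) / (N - p)"
  have k: "0 < k" using mu_pos c pN by (simp add: k_def)
  have k_eq: "k * (N - p) = \<mu> * c powr (p - 1)" using pN by (simp add: k_def)
  define G where "G r = - flux N p v r - k * r powr (N - p)" for r
  have G: "G b \<le> G r" if r: "b \<le> r" for r
  proof (rule DERIV_nonneg_imp_nondecreasing[OF r])
    fix y assume "b \<le> y"
    then have y: "R0 < y" "0 < y" "b \<le> y" using b by auto
    let ?d = "\<mu> * y powr (N - 1 - p) * v y powr (p - 1) + y powr (N - 1 + s) * v y powr q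
      - k * ((N - p) * y powr (N - p - 1))"
    have "(G has_real_derivative ?d) (at y)"
      unfolding G_def using y
      by (auto intro!: derivative_eq_intros flux_deriv[OF y(1)])
    moreover have "k * ((N - p) * y powr (N - p - 1)) = \<mu> * y powr (N - 1 - p) * c powr (p - 1)"
    proof -
      have "k * ((N - p) * y powr (N - p - 1)) = k * (N - p) * y powr (N - 1 - p)"
        by (simp add: diff_diff_eq add.commute)
      then show ?thesis by (simp add: k_eq)
    qed
    moreover have "\<mu> * y powr (N - 1 - p) * c powr (p - 1)
        \<le> \<mu> * y powr (N - 1 - p) * v y powr (p - 1)"
      using mu_pos vc[OF y(3)] c p1 by (intro mult_left_mono powr_mono2) auto
    moreover have "0 \<le> y powr (N - 1 + s) * v y powr q" by simp
    ultimately show "\<exists>d. (G has_real_derivative d) (at y) \<and> 0 \<le> d"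
      by (intro exI[of _ ?d] conjI) (assumption | linarith)+
  qed
  have "filterlim (\<lambda>r. k * r powr (N - p)) at_top at_top" using k pN by real_asymp
  then have "\<forall>\<^sub>F r in at_top. - G b < k * r powr (N - p)"
    by (simp add: filterlim_at_top_dense)
  then have "\<forall>\<^sub>F r in at_top. - G b < k * r powr (N - p) \<and> b \<le> r"
    using eventually_ge_at_top[of b] by (rule eventually_conj)
  then obtain r where "- G b < k * r powr (N - p)" "b \<le> r"
    using eventually_happens'[OF trivial_limit_at_top_linorder] by blast
  then show False using G[of r] nonneg[of r] b by (simp add: G_def)
qed

lemma deriv_neg_beyond: "\<exists>r1>R0. \<forall>r\<ge>r1. deriv v r < 0"
proof -
  obtain r1 where r1: "R0 < r1" "flux N p v r1 < 0" using ex_flux_neg by blast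
  have "deriv v r < 0" if "r1 \<le> r" for r
    using flux_less[OF r1(1), of r] r1 that flux_neg_iff[of r N p v] R0
    by (cases "r = r1") auto
  then show ?thesis using r1 by blast
qed

section \<open>Passage to logarithmic time and decay of the solution\<close>

text \<open>\<open>z\<close> is written through the flux because \<open>deriv v\<close> is only
  known to be continuous, while the flux is differentiable. In the product rule the flux contributes
  \<open>\<mu> + Y\<close>, the power of \<open>r\<close> contributes \<open>- (N - p) * z\<close>
  and the power of \<open>v\<close> contributes \<open>(p - 1) * x * z\<close>; the last two add up
  to \<open>- h N p x\<close>.\<close>

lemma logarithmic_system_solution:
  assumes r1: "R0 < r1" and neg: "\<And>r. r1 \<le> r \<Longrightarrow> deriv v r < 0"
    and mu_less: "\<mu> < ((N - p) / p) powr p" and qp: "q > p - 1" and ps: "s > - p"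
  shows "logarithmic_system N p s \<mu> q (ln r1) (x_of v)
    (\<lambda>t. - flux N p v (exp t) * exp t powr (p - N) * v (exp t) powr (1 - p)) (Y_of p s q v)"
proof
  fix t assume "ln r1 \<le> t"
  define r where "r = exp t"
  have r: "r1 \<le> r" "0 < r" "R0 < r"
    using exp_le_cancel_iff[of "ln r1" t] \<open>ln r1 \<le> t\<close> r1 R0 by (auto simp: r_def)
  note d = neg[OF r(1)] and vr = v_pos[OF r(3)]
  have x: "x_of v t = - (r * deriv v r / v r)" by (simp add: x_of_def r_def Let_def)
  have Y: "Y_of p s q v t = r powr (p + s) * v r powr (q - p + 1)"
    by (simp add: Y_of_def r_def Let_def)
  have der_r: "(exp has_real_derivative r) (at t)" by (simp add: r_def DERIV_exp)
  have dv: "((\<lambda>t. v (exp t)) has_real_derivative deriv v r * r) (at t)"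
    by (rule DERIV_chain2[OF _ der_r]) (use v_deriv r in \<open>simp add: r_def\<close>)
  have dw: "((\<lambda>t. flux N p v (exp t)) has_real_derivative
      - (\<mu> * r powr (N - 1 - p) * v r powr (p - 1) + r powr (N - 1 + s) * v r powr q) * r) (at t)"
    by (rule DERIV_chain2[OF _ der_r]) (use flux_deriv r in \<open>simp add: r_def\<close>)
  show xp: "0 < x_of v t"
    using d r vr by (simp add: x divide_neg_pos mult_pos_neg)
  show "0 < Y_of p s q v t" using r vr by (simp add: Y)
  \<comment> \<open>As \<open>v'\<close> is negative, the flux is \<open>- (r powr (N - 1))\<close>
    times the power \<open>p - 1\<close> of \<open>- v'\<close>.\<close>
  have z_eq: "- flux N p v r * r powr (p - N) * v r powr (1 - p) = x_of v t powr (p - 1)"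
  proof -
    define y where "y = - deriv v r"
    have y: "deriv v r = - y" "0 < y" using d by (simp_all add: y_def)
    have "y powr (p - 1) = y * y powr (p - 2)" using powr_mult_base[of y "p - 2"] y by simp
    then have "- flux N p v r = r powr (N - 1) * y powr (p - 1)"
      using y(2) by (simp add: flux_def y(1))
    moreover have "x_of v t = r * y / v r" by (simp add: x y(1))
    then have "x_of v t powr (p - 1) = r powr (p - 1) * y powr (p - 1) / v r powr (p - 1)"
      by (simp add: powr_divide powr_mult)
    moreover have "r powr (N - 1) * r powr (p - N) = r powr (p - 1)"
      by (simp flip: powr_add)
    moreover have "v r powr (1 - p) = 1 / v r powr (p - 1)"
      by (simp add: powr_minus_divide[symmetric])
    ultimately show ?thesis by (simp add: field_simps)
  qed
  then show "- flux N p v (exp t) * exp t powr (p - N) * v (exp t) powr (1 - p)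
      = x_of v t powr (p - 1)" by (simp add: r_def)
  have "((\<lambda>t. exp t powr (p + s) * v (exp t) powr (q - p + 1)) has_real_derivative
      ((p + s) * r powr (p + s - 1) * r * v r powr (q - p + 1) +
       r powr (p + s) * ((q - p + 1) * v r powr (q - p + 1 - 1) * (deriv v r * r)))) (at t)"
    using r vr by (auto intro!: derivative_eq_intros dv simp: r_def[symmetric])
  moreover have "r powr (p + s - 1) * r = r powr (p + s)"
    using r by (simp add: powr_diff)
  moreover have "v r powr (q - p + 1 - 1) = v r powr (q - p + 1) / v r"
    using powr_diff[of "v r" "q - p + 1" 1] vr by simp
  ultimately have "((\<lambda>t. exp t powr (p + s) * v (exp t) powr (q - p + 1)) has_real_derivative
      Y_of p s q v t * (p + s - (q - p + 1) * x_of v t)) (at t)"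
    by (elim DERIV_cong) (simp add: x Y algebra_simps)
  then show "(Y_of p s q v has_real_derivative
      Y_of p s q v t * (p + s - (q - p + 1) * x_of v t)) (at t)"
    by (simp add: Y_of_def[abs_def] Let_def)
  let ?w = "flux N p v r"
  let ?f = "\<mu> * r powr (N - 1 - p) * v r powr (p - 1) + r powr (N - 1 + s) * v r powr q"
  have "((\<lambda>t. - flux N p v (exp t) * exp t powr (p - N) * v (exp t) powr (1 - p))
    has_real_derivative
      ?f * r * r powr (p - N) * v r powr (1 - p)
      - ?w * ((p - N) * r powr (p - N - 1) * r) * v r powr (1 - p)
      - ?w * r powr (p - N) * ((1 - p) * v r powr (1 - p - 1) * (deriv v r * r))) (at t)"
    using r vr
    by (auto intro!: derivative_eq_intros dv dw simp: r_def[symmetric] algebra_simps)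
  moreover have "?f * r * r powr (p - N) * v r powr (1 - p) = \<mu> + Y_of p s q v t"
  proof -
    have "r powr e * r * r powr d = r powr (e + 1 + d)" for e d
      using r by (simp add: powr_add)
    then have "r powr (N - 1 - p) * r * r powr (p - N) = 1"
      "r powr (N - 1 + s) * r * r powr (p - N) = r powr (p + s)"
      using r by (simp_all add: algebra_simps)
    moreover have "v r powr (p - 1) * v r powr (1 - p) = 1"
      "v r powr q * v r powr (1 - p) = v r powr (q - p + 1)"
      using vr by (simp_all add: algebra_simps flip: powr_add)
    moreover have "?f * r * r powr (p - N) * v r powr (1 - p) =
      \<mu> * (r powr (N - 1 - p) * r * r powr (p - N)) * (v r powr (p - 1) * v r powr (1 - p))
      + (r powr (N - 1 + s) * r * r powr (p - N)) * (v r powr q * v r powr (1 - p))"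
      by (simp add: algebra_simps)
    ultimately show ?thesis by (simp add: Y)
  qed
  moreover have "?w * ((p - N) * r powr (p - N - 1) * r) * v r powr (1 - p)
      = (N - p) * x_of v t powr (p - 1)"
  proof -
    have "r powr (p - N - 1) * r = r powr (p - N)"
      using powr_diff[of r "p - N" 1] r by simp
    then show ?thesis unfolding z_eq[symmetric] by (simp add: mult.assoc) (simp add: algebra_simps)
  qed
  moreover have "?w * r powr (p - N) * ((1 - p) * v r powr (1 - p - 1) * (deriv v r * r))
      = - (p - 1) * x_of v t * x_of v t powr (p - 1)"
  proof -
    have "v r powr (1 - p - 1) = v r powr (1 - p) / v r"
      using powr_diff[of "v r" "1 - p" 1] vr by simp
    then show ?thesis unfolding z_eq[symmetric] unfolding x by (simp add: algebra_simps)
  qed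
  ultimately show "((\<lambda>t. - flux N p v (exp t) * exp t powr (p - N) * v (exp t) powr (1 - p))
      has_real_derivative \<mu> - h N p (x_of v t) + Y_of p s q v t) (at t)"
    by (elim DERIV_cong) (simp add: h_def algebra_simps)
qed (fact p1 pN mu_pos mu_less qp ps)+

text \<open>In logarithmic time the derivative of \<open>v\<close> is \<open>- x * v\<close>, at
  most \<open>- e * v\<close>, so \<open>v\<close> is bounded by a multiple of
  \<open>r powr (- e)\<close>.\<close>

lemma tendsto_0_if_x_of_ge:
  assumes "e > 0" and "\<forall>\<^sub>F t in at_top. e \<le> x_of v t"
  shows "(v \<longlongrightarrow> 0) at_top"
proof -
  obtain b where b: "\<And>t. b \<le> t \<Longrightarrow> e \<le> x_of v t"
    using assms(2) by (auto simp: eventually_at_top_linorder)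
  define c where "c = max b (ln R0 + 1)"
  have cR: "R0 < exp t" if "c \<le> t" for t
    using that R0 exp_less_mono[of "ln R0" t] by (simp add: c_def)
  have le: "v (exp t) \<le> v (exp c) * exp (- e * (t - c))" if t: "c \<le> t" for t
  proof -
    \<comment> \<open>\<open>exp_growth_ge\<close> gives lower bounds, so it is applied to the
      negated function.\<close>
    have "- v (exp c) * exp (- e * (t - c)) \<le> - v (exp t)"
    proof (rule exp_growth_ge[OF _ _ t])
      fix y assume y: "c \<le> y"
      show "((\<lambda>t. - v (exp t)) has_real_derivative x_of v y * v (exp y)) (at y)"
        using v_pos[OF cR[OF y]]
        by (auto intro!: derivative_eq_intros DERIV_chain2[OF v_deriv] cR y simp: x_of_def Let_def)
      have "e * v (exp y) \<le> x_of v y * v (exp y)"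
        using b[of y] y v_pos[OF cR[OF y]] by (intro mult_right_mono) (auto simp: c_def)
      then show "- e * - v (exp y) \<le> x_of v y * v (exp y)" by simp
    qed
    then show ?thesis by simp
  qed
  have "((\<lambda>t. v (exp t)) \<longlongrightarrow> 0) at_top"
  proof (rule tendsto_sandwich[where f = "\<lambda>_. 0"])
    show "((\<lambda>t. v (exp c) * exp (- e * (t - c))) \<longlongrightarrow> 0) at_top"
      using \<open>e > 0\<close> by real_asymp
    show "\<forall>\<^sub>F t in at_top. v (exp t) \<le> v (exp c) * exp (- e * (t - c))"
      using eventually_ge_at_top[of c] by eventually_elim (rule le)
    show "\<forall>\<^sub>F t in at_top. 0 \<le> v (exp t)"
      using eventually_ge_at_top[of c] by eventually_elim (use cR v_pos in \<open>auto intro: less_imp_le\<close>)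
  qed simp
  then have "((\<lambda>r. v (exp (ln r))) \<longlongrightarrow> 0) at_top"
    by (rule filterlim_compose[OF _ ln_at_top])
  moreover have "\<forall>\<^sub>F r in at_top. v (exp (ln r)) = v r"
    using eventually_gt_at_top[of 0] by eventually_elim simp
  ultimately show ?thesis by (rule Lim_transform_eventually)
qed

end

theorem theorem1p1:
  fixes N p s \<mu> q R0 :: real and v :: "real \<Rightarrow> real"
  assumes "1 < p" and "p < N"
    and "s > - p"
    and "0 < \<mu>" and "\<mu> < ((N - p) / p) powr p"
    and "q > p - 1"
    and "R0 > 0"
    and "positive_solution N p s \<mu> q R0 v"
  shows "(\<forall>\<^sub>F r in at_top. deriv v r < 0) \<and>
         (v \<longlongrightarrow> 0) at_top \<and>
         (\<exists>t0. t0 > ln R0 \<and>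
            (\<forall>t\<ge>t0. 0 < x_of v t \<and> x_of v t < nu_plus N p \<mu>) \<and>
            Liminf at_top (\<lambda>t. ereal (x_of v t)) > 0 \<and>
            (SUP t\<in>{t0..}. ereal (Y_of p s q v t)) < \<infinity>)"
proof -
  note sol = assms(1,2,4,7,8)
  obtain r1 where r1: "R0 < r1" "\<And>r. r1 \<le> r \<Longrightarrow> deriv v r < 0"
    using deriv_neg_beyond[OF sol] by blast
  \<comment> \<open>All bounds hold as soon as \<open>v'\<close> is negative, so
    \<open>ln r1\<close> serves as \<open>t0\<close>.\<close>
  interpret logarithmic_system N p s \<mu> q "ln r1" "x_of v"
    "\<lambda>t. - flux N p v (exp t) * exp t powr (p - N) * v (exp t) powr (1 - p)" "Y_of p s q v"
    using logarithmic_system_solution[OF sol r1 assms(5,6,3)] .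
  obtain e where e: "e > 0" "\<forall>\<^sub>F t in at_top. e \<le> x_of v t" using eventually_x_ge by blast
  obtain B where B: "\<And>t. ln r1 \<le> t \<Longrightarrow> Y_of p s q v t \<le> B" using Y_bounded by blast
  have "\<forall>\<^sub>F r in at_top. deriv v r < 0"
    using eventually_ge_at_top[of r1] by eventually_elim (rule r1)
  moreover have "(v \<longlongrightarrow> 0) at_top" using tendsto_0_if_x_of_ge[OF sol e] .
  moreover have "ln R0 < ln r1" using r1 assms by simp
  moreover have "\<forall>t\<ge>ln r1. 0 < x_of v t \<and> x_of v t < nu_plus N p \<mu>"
    using x_pos x_less_nu_plus by blast
  moreover have "ereal e \<le> Liminf at_top (\<lambda>t. ereal (x_of v t))"
    using e(2) by (intro Liminf_bounded) simp
  then have "0 < Liminf at_top (\<lambda>t. ereal (x_of v t))"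
    using e(1) by (meson ereal_less(2) less_le_trans)
  moreover have "(SUP t\<in>{ln r1..}. ereal (Y_of p s q v t)) \<le> ereal B"
    using B by (intro SUP_least) simp
  then have "(SUP t\<in>{ln r1..}. ereal (Y_of p s q v t)) < \<infinity>"
    by (rule le_less_trans) simp
  ultimately show ?thesis by blast
qed

end
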